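(* Let $p$ be an odd integer with $p \geq 3$. There is no function $f_p\colon\mathbb{N}\to\mathbb{N}$ such that $\mathrm{inv}^{= p}(T)\leq f_p(\mathrm{fas}(T))$ holds for every $(=p)$-invertible tournament $T$.
   Context: For an oriented graph $D$ and $X\subseteq V(D)$, the inversion of $X$ reverses the orientation of every arc with both endpoints in $X$. A $(=p)$-inversion is the inversion of a set of exactly $p$ vertices. $\mathrm{inv}^{=p}(D)$ is the minimum number of $(=p)$-inversions whose successive application makes $D$ acyclic ($+\infty$ if impossible), and $D$ is $(=p)$-invertible if $\mathrm{inv}^{=p}(D)<\infty$. $\mathrm{fas}(D)$ is the minimum size of a set of arcs whose deletion makes $D$ acyclic. *)

theory Defs
  imports "Graph_Theory.Pair_Digraph" "HOL-Library.Extended_Nat"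
begin

locale oriented_graph = pair_digraph +
  assumes no_digons: "(u, v) \<in> parcs G \<Longrightarrow> (v, u) \<notin> parcs G"

locale tournament = oriented_graph +
  assumes total_arcs: "total_on (pverts G) (parcs G)"

definition acyclic_digraph :: "'a pair_pre_digraph \<Rightarrow> bool" where
  "acyclic_digraph D \<longleftrightarrow> (\<nexists>c. pre_digraph.cycle (with_proj D) c)"

definition invert :: "'a set \<Rightarrow> 'a pair_pre_digraph \<Rightarrow> 'a pair_pre_digraph" where
  "invert X D = D\<lparr>parcs :=
     {(u, v). if u \<in> X \<and> v \<in> X then (v, u) \<in> parcs D else (u, v) \<in> parcs D}\<rparr>"

definition delete_arcs :: "'a rel \<Rightarrow> 'a pair_pre_digraph \<Rightarrow> 'a pair_pre_digraph" where
  "delete_arcs F D = D\<lparr>parcs := parcs D - F\<rparr>"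

definition fas :: "'a pair_pre_digraph \<Rightarrow> nat" where
  "fas D = (LEAST k. \<exists>F \<subseteq> parcs D. card F = k \<and> acyclic_digraph (delete_arcs F D))"

text \<open>The infimum of the empty set in \<^typ>\<open>enat\<close> is \<open>\<infinity>\<close>.\<close>

definition inv_eq :: "nat \<Rightarrow> 'a pair_pre_digraph \<Rightarrow> enat" where
  "inv_eq p D =
     (INF Xs \<in> {Xs. (\<forall>X \<in> set Xs. X \<subseteq> pverts D \<and> card X = p) \<and>
                    acyclic_digraph (fold invert Xs D)}. enat (length Xs))"

definition eq_invertible :: "nat \<Rightarrow> 'a pair_pre_digraph \<Rightarrow> bool" where
  "eq_invertible p D \<longleftrightarrow> inv_eq p D < \<infinity>"

end

theory Submission
  imports Defs
begin

text \<open>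
  Let \<open>T\<close> be the transitive tournament on \<open>0, \<dots>, n - 1\<close> with the arc between its source and its
  sink reversed, so that \<open>fas T \<le> 1\<close>. Suppose inversions of \<open>p\<close>-sets make \<open>T\<close> acyclic while some
  vertex \<open>j\<close> other than \<open>0\<close> and \<open>n - 1\<close> lies in none of the inverted sets. Since all arcs at \<open>j\<close>
  survive, all arcs between \<open>A = {0, \<dots>, j - 1}\<close> and \<open>B = {j + 1, \<dots>, n - 1}\<close> finally go from \<open>A\<close>
  to \<open>B\<close>, so exactly one of these arcs, namely \<open>(n - 1, 0)\<close>, was reversed an odd number of times.
  But an inverted set \<open>X\<close> avoids \<open>j\<close> and has odd size, hence it reverses an even number
  \<open>|X \<inter> A| |X \<inter> B|\<close> of them. So every such \<open>j\<close> is covered, and at least \<open>(n - 2) / p\<close> inversions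
  are needed.

  On the other hand, for a set \<open>S\<close> of \<open>p - 2\<close> further vertices, the four \<open>p\<close>-sets
  \<open>S \<union> {x, y}\<close> with \<open>x \<in> {a, b}\<close> and \<open>y \<in> {c, d}\<close> together reverse exactly the
  \<open>4\<close>-cycle \<open>a c b d\<close>. For even \<open>n\<close>, the edges joining \<open>{0, n - 1}\<close> to the other
  vertices are a disjoint union of \<open>4\<close>-cycles, and reversing them turns \<open>T\<close> into the transitive
  tournament with order \<open>n - 1, 1, \<dots>, n - 2, 0\<close>.
\<close>

section \<open>Two criteria for acyclicity\<close>

lemma acyclic_digraph_if_rank:
  fixes r :: "'a \<Rightarrow> nat"
  assumes "\<And>u v. (u, v) \<in> parcs D \<Longrightarrow> r u < r v"
  shows "acyclic_digraph D"
proof -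
  have rank: "c = [] \<or> r u < r v" if "pcas u c v" "set c \<subseteq> parcs D" for u c v
    using that
  proof (induction c arbitrary: u)
    case (Cons e c)
    then have "r u < r (snd e)" using assms[of "fst e" "snd e"] by auto
    moreover have "c = [] \<or> r (snd e) < r v" using Cons by auto
    ultimately show ?case using Cons.prems by auto
  qed simp
  show ?thesis
    unfolding acyclic_digraph_def pre_digraph.cycle_def pre_digraph.awalk_def
    using rank by (auto simp: cas_with_proj_eq)
qed

lemma acyclic_digraph_no_triangle:
  assumes "acyclic_digraph D" "a \<in> pverts D" "a \<noteq> b" "b \<noteq> c" "a \<noteq> c"
    and "(a, b) \<in> parcs D" "(b, c) \<in> parcs D"
  shows "(c, a) \<notin> parcs D"
proof
  assume "(c, a) \<in> parcs D"
  then have "pre_digraph.cycle (with_proj D) [(a, b), (b, c), (c, a)]"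
    unfolding pre_digraph.cycle_def pre_digraph.awalk_def
    using assms(2-) by (auto simp: cas_with_proj_eq awalk_verts_with_proj_eq intro!: exI[of _ a])
  with assms(1) show False unfolding acyclic_digraph_def by blast
qed

section \<open>Parities of inversion counts\<close>

text \<open>Its parity decides whether the arc between two vertices ends up reversed. Repeated sets
  in the list count separately.\<close>

definition codegree :: "'a set list \<Rightarrow> 'a \<Rightarrow> 'a \<Rightarrow> nat" where
  "codegree Xs u v = length (filter (\<lambda>X. u \<in> X \<and> v \<in> X) Xs)"

lemma codegree_Nil [simp]: "codegree [] u v = 0"
  and codegree_Cons [simp]:
    "codegree (X # Xs) u v = (if u \<in> X \<and> v \<in> X then 1 else 0) + codegree Xs u v"
  and codegree_append [simp]: "codegree (Xs @ Ys) u v = codegree Xs u v + codegree Ys u v"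
  by (simp_all add: codegree_def)

lemma codegree_commute: "codegree Xs u v = codegree Xs v u"
  by (simp add: codegree_def conj_commute)

lemma pverts_fold_invert [simp]: "pverts (fold invert Xs D) = pverts D"
  by (induction Xs arbitrary: D) (simp_all add: invert_def)

lemma in_parcs_fold_invert:
  "(u, v) \<in> parcs (fold invert Xs D) \<longleftrightarrow>
     (if odd (codegree Xs u v) then (v, u) \<in> parcs D else (u, v) \<in> parcs D)"
proof (induction Xs arbitrary: D)
  case (Cons X Xs)
  then show ?case by (auto simp: invert_def)
qed simp

text \<open>A set \<open>X\<close> contributes
  \<open>card (A \<inter> X) * card (B \<inter> X)\<close>; these factors have odd sum, so one of
  them is even.\<close>

lemma sum_codegree_even:
  assumes "finite A" "finite B" "A \<inter> B = {}"
    and "\<forall>X \<in> set Xs. X \<subseteq> A \<union> B \<and> odd (card X)"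
  shows "even (\<Sum>(a, b) \<in> A \<times> B. codegree Xs a b)"
  using assms(4)
proof (induction Xs)
  case (Cons X Xs)
  have X: "X \<subseteq> A \<union> B" "odd (card X)" using Cons.prems by auto
  have "X = (A \<inter> X) \<union> (B \<inter> X)" using X by blast
  then have "card X = card (A \<inter> X) + card (B \<inter> X)"
    using card_Un_disjoint[of "A \<inter> X" "B \<inter> X"] assms(1-3) by auto
  then have ev: "even (card (A \<inter> X) * card (B \<inter> X))" using X(2) by auto
  have "(\<Sum>(a, b) \<in> A \<times> B. if a \<in> X \<and> b \<in> X then 1 else 0 :: nat) =
      (\<Sum>e \<in> A \<times> B. if e \<in> X \<times> X then 1 else 0)"
    by (rule sum.cong) (auto split: if_splits)
  also have "\<dots> = card ((A \<times> B) \<inter> (X \<times> X))"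
    using assms(1,2) by (subst sum.inter_restrict[symmetric]) auto
  also have "(A \<times> B) \<inter> (X \<times> X) = (A \<inter> X) \<times> (B \<inter> X)" by auto
  finally have "(\<Sum>(a, b) \<in> A \<times> B. if a \<in> X \<and> b \<in> X then 1 else 0 :: nat) =
      card (A \<inter> X) * card (B \<inter> X)"
    by (simp add: card_cartesian_product)
  moreover have "(\<Sum>(a, b) \<in> A \<times> B. codegree (X # Xs) a b) =
      (\<Sum>(a, b) \<in> A \<times> B. if a \<in> X \<and> b \<in> X then 1 else 0) + (\<Sum>(a, b) \<in> A \<times> B. codegree Xs a b)"
    by (simp add: sum.distrib case_prod_beta)
  ultimately show ?case using ev Cons by simp
qed (simp add: case_prod_beta)

text \<open>Pairs inside \<open>S\<close> lie in all four sets, pairs joining \<open>S\<close> to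
  the cycle in two, the diagonals \<open>a b\<close> and \<open>c d\<close> in none, and each edge
  of the cycle in exactly one.\<close>

lemma four_cycle_inversions:
  assumes "finite V" "p \<ge> 2" "p + 2 \<le> card V" "distinct [a, b, c, d]" "{a, b, c, d} \<subseteq> V"
  shows "\<exists>Xs. (\<forall>X \<in> set Xs. X \<subseteq> V \<and> card X = p) \<and>
    (\<forall>u v. u \<noteq> v \<longrightarrow> odd (codegree Xs u v) =
       (u \<in> {a, b} \<and> v \<in> {c, d} \<or> u \<in> {c, d} \<and> v \<in> {a, b}))"
proof -
  have "card (V - {a, b, c, d}) = card V - 4"
    using assms by (subst card_Diff_subset) auto
  then have "p - 2 \<le> card (V - {a, b, c, d})" using assms by simp
  then obtain S where S: "S \<subseteq> V - {a, b, c, d}" "card S = p - 2" "finite S"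
    by (rule obtain_subset_with_card_n)
  define Xs where "Xs = map (\<lambda>(x, y). insert x (insert y S)) [(a, c), (a, d), (b, c), (b, d)]"
  have "\<forall>X \<in> set Xs. X \<subseteq> V \<and> card X = p"
    using S assms by (auto simp: Xs_def card_insert_if)
  moreover have "odd (codegree Xs u v) =
      (u \<in> {a, b} \<and> v \<in> {c, d} \<or> u \<in> {c, d} \<and> v \<in> {a, b})" if "u \<noteq> v" for u v
  proof -
    have "a \<notin> S" "b \<notin> S" "c \<notin> S" "d \<notin> S" using S by auto
    then show ?thesis using assms(4) that
      by (cases "u \<in> S"; cases "v \<in> S"; auto simp: Xs_def)
  qed
  ultimately show ?thesis by (intro exI[of _ Xs] conjI allI impI)
qed

section \<open>The tournament and its invertibility\<close>

definition back_arc_tournament :: "nat \<Rightarrow> nat pair_pre_digraph" where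
  "back_arc_tournament n =
     \<lparr>pverts = {..<n}, parcs = insert (n - 1, 0) ({(u, v). u < v \<and> v < n} - {(0, n - 1)})\<rparr>"

lemma back_arc_tournament_sel [simp]:
  "pverts (back_arc_tournament n) = {..<n}"
  "parcs (back_arc_tournament n) = insert (n - 1, 0) ({(u, v). u < v \<and> v < n} - {(0, n - 1)})"
  by (simp_all add: back_arc_tournament_def)

lemma tournament_back_arc_tournament:
  assumes "n \<ge> 2"
  shows "tournament (back_arc_tournament n)"
proof
  have "parcs (back_arc_tournament n) \<subseteq> {..<n} \<times> {..<n}" using assms by auto
  then show "finite (parcs (back_arc_tournament n))" by (rule finite_subset) simp
qed (use assms in \<open>auto simp: total_on_def\<close>)

lemma fas_back_arc_tournament: "fas (back_arc_tournament n) \<le> 1"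
proof -
  have "acyclic_digraph (delete_arcs {(n - 1, 0)} (back_arc_tournament n))"
    by (rule acyclic_digraph_if_rank[where r = id]) (auto simp: delete_arcs_def)
  then show ?thesis
    unfolding fas_def by (intro Least_le exI[of _ "{(n - 1, 0)}"]) auto
qed

text \<open>Each induction step adds the 4-cycle through both ends and the next two inner
  vertices.\<close>

lemma ends_to_middle_inversions:
  assumes "p \<ge> 2" "p + 2 \<le> n" "2 * i + 2 \<le> n"
  shows "\<exists>Xs. (\<forall>X \<in> set Xs. X \<subseteq> {..<n} \<and> card X = p) \<and>
    (\<forall>u v. u \<noteq> v \<longrightarrow> odd (codegree Xs u v) =
       (u \<in> {0, n - 1} \<and> v \<in> {1..2 * i} \<or> u \<in> {1..2 * i} \<and> v \<in> {0, n - 1}))"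
  using assms(3)
proof (induction i)
  case 0
  show ?case by (rule exI[of _ "[]"]) auto
next
  case (Suc i)
  have "2 * i + 2 \<le> n" using Suc.prems by simp
  from Suc.IH[OF this] obtain Xs where Xs: "\<forall>X \<in> set Xs. X \<subseteq> {..<n} \<and> card X = p"
    "\<forall>u v. u \<noteq> v \<longrightarrow> odd (codegree Xs u v) =
       (u \<in> {0, n - 1} \<and> v \<in> {1..2 * i} \<or> u \<in> {1..2 * i} \<and> v \<in> {0, n - 1})"
    by (elim exE conjE) (rule that)
  have "distinct [0, n - 1, 2 * i + 1, 2 * i + 2]" "{0, n - 1, 2 * i + 1, 2 * i + 2} \<subseteq> {..<n}"
    "p + 2 \<le> card {..<n}"
    using Suc.prems assms by auto
  from four_cycle_inversions[OF finite_lessThan assms(1) this(3,1,2)]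
  obtain Ys where Ys: "\<forall>X \<in> set Ys. X \<subseteq> {..<n} \<and> card X = p"
    "\<forall>u v. u \<noteq> v \<longrightarrow> odd (codegree Ys u v) =
       (u \<in> {0, n - 1} \<and> v \<in> {2 * i + 1, 2 * i + 2} \<or> u \<in> {2 * i + 1, 2 * i + 2} \<and> v \<in> {0, n - 1})"
    by (elim exE conjE) (rule that)
  \<comment> \<open>Concatenation combines the parities by exclusive or; since the old and new edges
    are disjoint, this is their union.\<close>
  have split: "w \<in> {1..2 * Suc i} \<longleftrightarrow> w \<in> {1..2 * i} \<or> w \<in> {2 * i + 1, 2 * i + 2}"
    and disj: "\<not> (w \<in> {1..2 * i} \<and> w \<in> {2 * i + 1, 2 * i + 2})"
    and ends: "\<not> (w \<in> {0, n - 1} \<and> (w \<in> {1..2 * i} \<or> w \<in> {2 * i + 1, 2 * i + 2}))" for w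
    using Suc.prems by auto
  have "odd (codegree (Xs @ Ys) u v) =
      (u \<in> {0, n - 1} \<and> v \<in> {1..2 * Suc i} \<or> u \<in> {1..2 * Suc i} \<and> v \<in> {0, n - 1})"
    if "u \<noteq> v" for u v
    unfolding codegree_append odd_add Xs(2)[rule_format, OF that] Ys(2)[rule_format, OF that] split
    using disj[of u] disj[of v] ends[of u] ends[of v] by argo
  with Xs(1) Ys(1) show ?case by (intro exI[of _ "Xs @ Ys"]) auto
qed

lemma eq_invertible_back_arc_tournament:
  assumes "p \<ge> 2" "p + 2 \<le> n" "even n"
  shows "eq_invertible p (back_arc_tournament n)"
proof -
  define i where "i = (n - 2) div 2"
  have i: "2 * i = n - 2" using assms by (simp add: i_def)
  have "n - 2 + 2 \<le> n" using assms by simp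
  from ends_to_middle_inversions[OF assms(1,2), of i, unfolded i, OF this]
  obtain Xs where Xs: "\<forall>X \<in> set Xs. X \<subseteq> {..<n} \<and> card X = p"
    "\<forall>u v. u \<noteq> v \<longrightarrow> odd (codegree Xs u v) =
       (u \<in> {0, n - 1} \<and> v \<in> {1..n - 2} \<or> u \<in> {1..n - 2} \<and> v \<in> {0, n - 1})"
    by (elim exE conjE) (rule that)
  define r where "r v = (if v = 0 then n else if v = n - 1 then 0 else v)" for v
  have "acyclic_digraph (fold invert Xs (back_arc_tournament n))"
  proof (rule acyclic_digraph_if_rank[where r = r])
    fix u v assume uv: "(u, v) \<in> parcs (fold invert Xs (back_arc_tournament n))"
    \<comment> \<open>The parity description covers distinct vertices only, so loops are excluded
      first.\<close>
    have "u \<noteq> v"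
      using uv assms unfolding in_parcs_fold_invert by (auto split: if_splits)
    from uv show "r u < r v"
      unfolding in_parcs_fold_invert Xs(2)[rule_format, OF \<open>u \<noteq> v\<close>] r_def
      using assms by (auto split: if_splits)
  qed
  then have "inv_eq p (back_arc_tournament n) \<le> enat (length Xs)"
    unfolding inv_eq_def using Xs(1) by (intro INF_lower) simp
  then show ?thesis
    unfolding eq_invertible_def using enat_ord_simps(4) le_less_trans by blast
qed

section \<open>The lower bound\<close>

lemma inner_vertex_covered:
  assumes "odd p" and Xs: "\<forall>X \<in> set Xs. X \<subseteq> {..<n} \<and> card X = p"
    and acyc: "acyclic_digraph (fold invert Xs (back_arc_tournament n))"
    and j: "0 < j" "j < n - 1"
  shows "j \<in> \<Union> (set Xs)"
proof (rule ccontr)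
  assume nj: "j \<notin> \<Union> (set Xs)"
  let ?D = "fold invert Xs (back_arc_tournament n)"
  let ?A = "{..<j}" and ?B = "{j<..<n}"
  have zero: "codegree Xs a j = 0" "codegree Xs j a = 0" for a
    using nj by (auto simp: codegree_def filter_empty_conv)
  \<comment> \<open>The arcs \<open>(a, j)\<close> and \<open>(j, b)\<close> survive, so a final arc
    \<open>(b, a)\<close> would close a triangle. Initially only \<open>(n - 1, 0)\<close> goes from
    \<open>?B\<close> to \<open>?A\<close>.\<close>
  have parity: "odd (codegree Xs a b) \<longleftrightarrow> (a, b) = (0, n - 1)" if "a \<in> ?A" "b \<in> ?B" for a b
  proof -
    have "(a, j) \<in> parcs ?D" "(j, b) \<in> parcs ?D"
      using that j unfolding in_parcs_fold_invert zero by auto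
    then have "(b, a) \<notin> parcs ?D"
      using that by (intro acyclic_digraph_no_triangle[OF acyc]) auto
    then show ?thesis
      using that j unfolding in_parcs_fold_invert codegree_commute[of Xs b a]
      by (auto split: if_splits)
  qed
  have "even (\<Sum>(a, b) \<in> ?A \<times> ?B. codegree Xs a b)"
  proof (rule sum_codegree_even)
    show "\<forall>X \<in> set Xs. X \<subseteq> ?A \<union> ?B \<and> odd (card X)"
    proof
      fix X assume "X \<in> set Xs"
      then have "X \<subseteq> {..<n}" "card X = p" "j \<notin> X" using Xs nj by auto
      moreover have "?A \<union> ?B = {..<n} - {j}" using j by auto
      ultimately show "X \<subseteq> ?A \<union> ?B \<and> odd (card X)" using \<open>odd p\<close> by auto
    qed
  qed auto
  moreover have "odd (\<Sum>(a, b) \<in> ?A \<times> ?B. codegree Xs a b)"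
  proof -
    have "odd (case e of (a, b) \<Rightarrow> codegree Xs a b) \<longleftrightarrow> e = (0, n - 1)" if "e \<in> ?A \<times> ?B" for e
      using that parity[of "fst e" "snd e"] by (simp add: case_prod_beta mem_Times_iff)
    moreover have "(0, n - 1) \<in> ?A \<times> ?B" using j by auto
    \<comment> \<open>A sum has the parity of its number of odd terms, here one.\<close>
    ultimately have "{e \<in> ?A \<times> ?B. odd (case e of (a, b) \<Rightarrow> codegree Xs a b)} = {(0, n - 1)}"
      by blast
    then show ?thesis by (subst even_sum_iff) simp_all
  qed
  ultimately show False by contradiction
qed

lemma back_arc_tournament_inversions_ge:
  assumes "odd p" and Xs: "\<forall>X \<in> set Xs. X \<subseteq> {..<n} \<and> card X = p"
    and "acyclic_digraph (fold invert Xs (back_arc_tournament n))"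
  shows "n - 2 \<le> length Xs * p"
proof -
  have fin: "finite (\<Union> (set Xs))" using Xs finite_subset by blast
  have "{0<..<n - 1} \<subseteq> \<Union> (set Xs)" using inner_vertex_covered[OF assms] by auto
  from card_mono[OF fin this] have "n - 2 \<le> card (\<Union> (set Xs))" by simp
  also have "\<dots> \<le> (\<Sum>X \<in> set Xs. card X)" by (rule card_Union_le_sum_card)
  also have "\<dots> = card (set Xs) * p" using Xs by simp
  also have "\<dots> \<le> length Xs * p" by (simp add: card_length)
  finally show ?thesis .
qed

theorem theorem4p15:
  fixes p :: nat
  assumes "odd p" and "p \<ge> 3"
  shows "\<not> (\<exists>f :: nat \<Rightarrow> nat. \<forall>T :: nat pair_pre_digraph.
           tournament T \<and> eq_invertible p T \<longrightarrow> inv_eq p T \<le> enat (f (fas T)))"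
proof
  assume "\<exists>f :: nat \<Rightarrow> nat. \<forall>T :: nat pair_pre_digraph.
    tournament T \<and> eq_invertible p T \<longrightarrow> inv_eq p T \<le> enat (f (fas T))"
  then obtain f :: "nat \<Rightarrow> nat" where f: "\<And>T :: nat pair_pre_digraph.
    tournament T \<Longrightarrow> eq_invertible p T \<Longrightarrow> inv_eq p T \<le> enat (f (fas T))" by blast
  \<comment> \<open>Only \<open>fas ?T \<le> 1\<close> is known, so \<open>K\<close> bounds
    \<open>f\<close> at both possible values.\<close>
  define K where "K = max (f 0) (f 1)"
  \<comment> \<open>Even, as invertibility requires here, and large enough that \<open>K\<close>
    sets of size \<open>p\<close> cannot cover the \<open>n - 2\<close> inner vertices.\<close>
  define n where "n = 2 * (p * (K + 1) + 2)"
  let ?T = "back_arc_tournament n"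
  have n: "p + 2 \<le> n" "even n" "n - 2 > K * p" using assms(2) by (auto simp: n_def algebra_simps)
  have "inv_eq p ?T \<le> enat (f (fas ?T))"
    using n assms by (intro f tournament_back_arc_tournament eq_invertible_back_arc_tournament) auto
  also have "\<dots> \<le> enat K"
  proof -
    have "fas ?T = 0 \<or> fas ?T = 1" using fas_back_arc_tournament[of n] by linarith
    then show ?thesis by (auto simp: K_def)
  qed
  finally have "inv_eq p ?T < enat (Suc K)" by (simp add: le_less_trans)
  then obtain Xs where Xs: "\<forall>X \<in> set Xs. X \<subseteq> pverts ?T \<and> card X = p"
    "acyclic_digraph (fold invert Xs ?T)" "length Xs < Suc K"
    unfolding inv_eq_def INF_less_iff by auto
  have "n - 2 \<le> length Xs * p"
    using Xs by (intro back_arc_tournament_inversions_ge[OF assms(1)]) auto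
  also have "\<dots> \<le> K * p" using Xs(3) by simp
  finally show False using n(3) by simp
qed

end
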